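(* Let $E$ be a real vector space of dimension $n\ge 1$, let $\mathcal G:E\to E^*$ be an oracle, $x_0\in E$, $R>0$, and assume there is $x^*\in B(x_0,R)$ with $\langle \mathcal G(x),x-x^*\rangle\ge 0$ for all $x\in E$. Run the General Scheme (see context) with coefficients $$a_k=\frac{\frac12\theta\gamma R_k}{\|g_k\|_{G_k}^*},\qquad b_k=\frac{\gamma}{(\|g_k\|_{G_k}^* )^2},\qquad k\ge 0,$$ where $$\theta=\sqrt2-1,\qquad \gamma=\frac{2}{\sqrt{4n^2-1}+2n-1}.$$ Assume $g_k\ne 0$ for all $k\ge 0$. Then, for all $k\ge 1$, the sliding gap $\Delta_k$ satisfies $$\Delta_k\le 6e^{-k/(8n^2)}R.$$
   Context: $E^*$ is the dual of $E$ and $\langle s,x\rangle$ is the value of $s\in E^*$ at $x\in E$. A self-adjoint positive definite operator $B:E\to E^*$ is fixed; $\|x\|=\langle Bx,x\rangle^{1/2}$ for $x\in E$, $\|s\|_*=\langle s,B^{-1}s\rangle^{1/2}$ for $s\in E^*$, $B(x_0,R)=\{x\in E:\|x-x_0\|\le R\}$. For a self-adjoint positive definite $G:E\to E^*$: $\|x\|_G=\langle Gx,x\rangle^{1/2}$, $\|s\|_G^*=\langle s,G^{-1}s\rangle^{1/2}$. For $s\in E^*$, $ss^*:E\to E^*$ is the rank-one operator $x\mapsto\langle s,x\rangle s$. General Scheme. Put $\ell_0(x)=0$, $\omega_0(x)=\frac12\|x-x_0\|^2$. For $k\ge 0$: (1) $g_k=\mathcal G(x_k)$; (2) $U_k=\max_{x\in\Omega_k\cap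 L_k^-}\langle g_k,x_k-x\rangle$, where $\Omega_k=\{x\in E:\omega_k(x)\le\frac12R^2\}$ and $L_k^-=\{x\in E:\ell_k(x)\le 0\}$; (3) with coefficients $a_k,b_k\ge 0$, set $\ell_{k+1}(x)=\ell_k(x)+a_k\langle g_k,x-x_k\rangle$ and $\omega_{k+1}(x)=\omega_k(x)+\frac12 b_k\bigl(U_k-\langle g_k,x_k-x\rangle\bigr)\langle g_k,x-x_k\rangle$; (4) $x_{k+1}=\arg\min_{x\in E}[\ell_{k+1}(x)+\omega_{k+1}(x)]$. Associated quantities: $G_0=B$, $G_{k+1}=G_k+b_kg_kg_k^*$ (the Hessian of $\omega_k$ is $G_k$); $R_0=R$, $R_k>0$ and $R_{k+1}^2=R_k^2+(a_k+\frac12b_kU_k)^2\dfrac{(\|g_k\|_{G_k}^* )^2}{1+b_k(\|g_k\|_{G_k}^* )^2}$. Sliding gap: for $k\ge 1$ with $\Gamma_k=\sum_{i=0}^{k-1}a_i\|g_i\|_*>0$, $\Delta_k=\max_{x\in\Omega_k}\frac1{\Gamma_k}[-\ell_k(x)]=\max_{x\in\Omega_k}\frac{1}{\Gamma_k}\sum_{i=0}^{k-1}a_i\langle g_i,x_i-x\rangle$. *)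

theory Defs
  imports "HOL-Analysis.Analysis"
begin

text \<open>
  The space \<open>E\<close> is a type of class \<open>euclidean_space\<close>; only its finite-dimensional vector space
  structure matters below, since all norms come from an arbitrary positive definite operator \<open>B\<close>
  that is unrelated to the inner product of the type class. All linear maps on \<open>E\<close> are bounded,
  so \<open>E \<Rightarrow>\<^sub>L real\<close> is the full dual and \<open>s x\<close> is the value of \<open>s\<close> at \<open>x\<close>.
\<close>

type_synonym 'a dual = "'a \<Rightarrow>\<^sub>L real"

definition self_adjoint_pos_def :: "('a::euclidean_space \<Rightarrow>\<^sub>L 'a dual) \<Rightarrow> bool" where
  "self_adjoint_pos_def G \<longleftrightarrow> (\<forall>x y. G x y = G y x) \<and> (\<forall>x. x \<noteq> 0 \<longrightarrow> G x x > 0)"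

definition pnorm :: "('a::euclidean_space \<Rightarrow>\<^sub>L 'a dual) \<Rightarrow> 'a \<Rightarrow> real" where
  "pnorm G x = sqrt (G x x)"

definition dnorm :: "('a::euclidean_space \<Rightarrow>\<^sub>L 'a dual) \<Rightarrow> 'a dual \<Rightarrow> real" where
  "dnorm G s = sqrt (s (inv (blinfun_apply G) s))"

definition rank_one :: "'a::euclidean_space dual \<Rightarrow> 'a \<Rightarrow>\<^sub>L 'a dual" where
  "rank_one s = Blinfun (\<lambda>x. s x *\<^sub>R s)"

lemma rank_one_apply [simp]: "rank_one s x = s x *\<^sub>R s"
  unfolding rank_one_def
  by (intro bounded_linear_Blinfun_apply[THEN fun_cong] bounded_linear_intros)

definition is_maximum :: "('a \<Rightarrow> real) \<Rightarrow> 'a set \<Rightarrow> real \<Rightarrow> bool" where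
  "is_maximum f S m \<longleftrightarrow> (\<exists>y\<in>S. f y = m) \<and> (\<forall>y\<in>S. f y \<le> m)"

definition Omega_set :: "real \<Rightarrow> ('a \<Rightarrow> real) \<Rightarrow> 'a set" where
  "Omega_set R w = {y. w y \<le> 1/2 * R\<^sup>2}"

text \<open>
  The sequences \<open>x, g, U, l, w\<close> (the last two being \<open>\<ell>\<close> and \<open>\<omega>\<close>) form a run of the scheme for
  the oracle \<open>Or\<close> with coefficients \<open>a, b\<close>.
\<close>

definition general_scheme ::
  "('a::euclidean_space \<Rightarrow>\<^sub>L 'a dual) \<Rightarrow> ('a \<Rightarrow> 'a dual) \<Rightarrow> 'a \<Rightarrow> real \<Rightarrow>
   (nat \<Rightarrow> real) \<Rightarrow> (nat \<Rightarrow> real) \<Rightarrow>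
   (nat \<Rightarrow> 'a) \<Rightarrow> (nat \<Rightarrow> 'a dual) \<Rightarrow> (nat \<Rightarrow> real) \<Rightarrow>
   (nat \<Rightarrow> 'a \<Rightarrow> real) \<Rightarrow> (nat \<Rightarrow> 'a \<Rightarrow> real) \<Rightarrow> bool" where
  "general_scheme B Or x0 R a b x g U l w \<longleftrightarrow>
     x 0 = x0 \<and>
     l 0 = (\<lambda>y. 0) \<and>
     w 0 = (\<lambda>y. 1/2 * (pnorm B (y - x0))\<^sup>2) \<and>
     (\<forall>k. a k \<ge> 0 \<and> b k \<ge> 0 \<and>
        g k = Or (x k) \<and>
        is_maximum (\<lambda>y. g k (x k - y)) (Omega_set R (w k) \<inter> {y. l k y \<le> 0}) (U k) \<and>
        l (Suc k) = (\<lambda>y. l k y + a k * g k (y - x k)) \<and>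
        w (Suc k) = (\<lambda>y. w k y + 1/2 * b k * (U k - g k (x k - y)) * g k (y - x k)) \<and>
        is_arg_min (\<lambda>y. l (Suc k) y + w (Suc k) y) (\<lambda>y. True) (x (Suc k)))"

primrec hess_op ::
  "('a::euclidean_space \<Rightarrow>\<^sub>L 'a dual) \<Rightarrow> (nat \<Rightarrow> real) \<Rightarrow> (nat \<Rightarrow> 'a dual) \<Rightarrow> nat \<Rightarrow>
   ('a \<Rightarrow>\<^sub>L 'a dual)" where
  "hess_op B b g 0 = B"
| "hess_op B b g (Suc k) = hess_op B b g k + b k *\<^sub>R rank_one (g k)"

primrec radius ::
  "('a::euclidean_space \<Rightarrow>\<^sub>L 'a dual) \<Rightarrow> real \<Rightarrow> (nat \<Rightarrow> real) \<Rightarrow> (nat \<Rightarrow> real) \<Rightarrow>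
   (nat \<Rightarrow> 'a dual) \<Rightarrow> (nat \<Rightarrow> real) \<Rightarrow> nat \<Rightarrow> real" where
  "radius B R a b g U 0 = R"
| "radius B R a b g U (Suc k) =
     sqrt ((radius B R a b g U k)\<^sup>2 +
       (a k + 1/2 * b k * U k)\<^sup>2 *
       ((dnorm (hess_op B b g k) (g k))\<^sup>2 / (1 + b k * (dnorm (hess_op B b g k) (g k))\<^sup>2)))"

definition Gamma_sum ::
  "('a::euclidean_space \<Rightarrow>\<^sub>L 'a dual) \<Rightarrow> (nat \<Rightarrow> real) \<Rightarrow> (nat \<Rightarrow> 'a dual) \<Rightarrow> nat \<Rightarrow> real" where
  "Gamma_sum B a g k = (\<Sum>i<k. a i * dnorm B (g i))"

text \<open>\<open>D\<close> is the sliding gap at step \<open>k\<close>, including the conditions under which it is defined.\<close>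

definition is_sliding_gap ::
  "('a::euclidean_space \<Rightarrow>\<^sub>L 'a dual) \<Rightarrow> real \<Rightarrow> (nat \<Rightarrow> real) \<Rightarrow> (nat \<Rightarrow> 'a dual) \<Rightarrow>
   (nat \<Rightarrow> 'a \<Rightarrow> real) \<Rightarrow> (nat \<Rightarrow> 'a \<Rightarrow> real) \<Rightarrow> nat \<Rightarrow> real \<Rightarrow> bool" where
  "is_sliding_gap B R a g l w k D \<longleftrightarrow>
     k \<ge> 1 \<and> Gamma_sum B a g k > 0 \<and>
     is_maximum (\<lambda>y. 1 / Gamma_sum B a g k * (- l k y)) (Omega_set R (w k)) D"

end

(* The sum l_k + w_k is a quadratic with Hessian G_k and minimum (R^2 - R_k^2)/2 at x_k, so -l_k <= R_k^2/2
   on Omega_k; with these coefficients R_k^2 grows at most by the factor q = 1 + gamma^2/(2(1+gamma)) per step.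
   On the other hand det(B^-1 G_k) = (1+gamma)^k, and the AM-GM inequality turns this into a lower bound for
   the trace of B^-1 G_k, hence for Gamma_k, of order (1+gamma)^(k/(2n)). The ratio of the two bounds decays
   like exp(-k/(8n^2)), but it is useless while k < 2n^2: there one uses instead that the localizers have radius
   R_i around x_i and share the point x*, which gives a gap of at most 3 R_k. *)

theory Submission
  imports Defs
begin

section \<open>Positive definite forms\<close>

text \<open>Put u = ln (1 + \<gamma>) and s = 1/(2n). Then q = cosh u, and the ratio of the two
  bounds behaves like exp (k (ln cosh u - s u)). The exponent is smallest at tanh u = s, that is (1
  + \<gamma>)^2 = (1 + s)/(1 - s), which is the \<gamma> of the statement. The minimum of ln cosh u
  - s u is minus half of (1 + s) ln (1 + s) + (1 - s) ln (1 - s), a quantity that is at least s^2;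
  hence the rate s^2/2 = 1/(8n^2). The value of \<theta> is tied to q: a_k + b_k U_k / 2 is at most
  (1 + \<theta>) \<gamma> R_k / (2 \<nu>_k), with \<nu>_k the dual norm of g_k for G_k, and (1 +
  \<theta>)^2 = 2. The trace bound has the form n ((1 + \<gamma>)^(k/n) - 1), which is comparable to
  the power itself once that power is at least 2; this holds for k >= 2n^2. The constant 6 serves
  both regimes: it bounds 2/\<theta> for large k, and is 3 times 2 for small k. Since G_k maps E to
  its dual, determinant and trace make sense only relative to B; both are read off in one
  B-orthonormal basis that stays fixed for all k.\<close>

lemma spd_sym: "self_adjoint_pos_def G \<Longrightarrow> G x y = G y x"
  by (simp add: self_adjoint_pos_def_def)

lemma spd_pos: "self_adjoint_pos_def G \<Longrightarrow> x \<noteq> 0 \<Longrightarrow> G x x > 0"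
  by (simp add: self_adjoint_pos_def_def)

lemma spd_nonneg: "self_adjoint_pos_def G \<Longrightarrow> G x x \<ge> 0"
  by (cases "x = 0") (auto simp: blinfun.bilinear_simps dest: spd_pos[of G x])

lemma spd_eq_0: "self_adjoint_pos_def G \<Longrightarrow> G x x \<le> 0 \<Longrightarrow> x = 0"
  by (meson not_less spd_pos)

lemma pnorm_square: "self_adjoint_pos_def G \<Longrightarrow> (pnorm G x)\<^sup>2 = G x x"
  by (simp add: pnorm_def spd_nonneg)

lemma pnorm_nonneg: "self_adjoint_pos_def G \<Longrightarrow> pnorm G x \<ge> 0"
  by (simp add: pnorm_def spd_nonneg)

lemma pnorm_commute: "pnorm G (x - y) = pnorm G (y - x)"
proof -
  have "G (x - y) (x - y) = G (y - x) (y - x)"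
    by (simp add: blinfun.bilinear_simps)
  then show ?thesis by (simp add: pnorm_def)
qed

lemma spd_square_add:
  assumes "self_adjoint_pos_def G"
  shows "G (x + y) (x + y) = G x x + 2 * G x y + G y y"
  using spd_sym[OF assms, of y x] by (simp add: blinfun.bilinear_simps)

lemma spd_Cauchy_Schwarz:
  assumes G: "self_adjoint_pos_def G"
  shows "\<bar>G x y\<bar> \<le> pnorm G x * pnorm G y"
proof (cases "y = 0")
  case True
  then show ?thesis
    by (simp add: blinfun.bilinear_simps pnorm_def)
next
  case False
  define t where "t = G x y / G y y"
  have pos: "G y y > 0" using spd_pos[OF G False] .
  have "0 \<le> G (x + (-t) *\<^sub>R y) (x + (-t) *\<^sub>R y)"
    by (rule spd_nonneg[OF G])
  also have "\<dots> = G x x - 2 * t * G x y + t * t * G y y"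
    unfolding spd_square_add[OF G] by (simp add: blinfun.bilinear_simps)
  also have "\<dots> = G x x - (G x y)\<^sup>2 / G y y"
    using pos by (simp add: t_def field_simps power2_eq_square)
  finally have "(G x y)\<^sup>2 \<le> G x x * G y y"
    using pos by (simp add: field_simps)
  then have "sqrt ((G x y)\<^sup>2) \<le> sqrt (G x x * G y y)"
    by (rule real_sqrt_le_mono)
  then show ?thesis by (simp add: pnorm_def real_sqrt_mult)
qed

lemma pnorm_triangle:
  assumes G: "self_adjoint_pos_def G"
  shows "pnorm G (x + y) \<le> pnorm G x + pnorm G y"
proof (rule power2_le_imp_le)
  have "G x y \<le> pnorm G x * pnorm G y"
    using spd_Cauchy_Schwarz[OF G, of x y] by linarith
  then show "(pnorm G (x + y))\<^sup>2 \<le> (pnorm G x + pnorm G y)\<^sup>2"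
    by (simp add: pnorm_square[OF G] spd_square_add[OF G] power2_sum)
qed (simp add: G pnorm_nonneg)

lemma blinfun_eq_0_on_span:
  fixes s :: "'a::euclidean_space dual"
  assumes "\<And>x. x \<in> S \<Longrightarrow> s x = 0" and "y \<in> span S"
  shows "s y = 0"
  using linear_eq_0_on_span[of "blinfun_apply s" S y] assms
    bounded_linear.linear[OF blinfun.bounded_linear_right[of s]] by blast

section \<open>Orthonormal bases of a positive definite form, representers and dual norms\<close>

definition orthonormal_family ::
  "('a::euclidean_space \<Rightarrow>\<^sub>L 'a dual) \<Rightarrow> nat \<Rightarrow> (nat \<Rightarrow> 'a) \<Rightarrow> bool" where
  "orthonormal_family G m e \<longleftrightarrow> (\<forall>i<m. \<forall>j<m. G (e i) (e j) = of_bool (i = j))"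

lemma ex_orthonormal_family:
  fixes G :: "'a::euclidean_space \<Rightarrow>\<^sub>L 'a dual"
  assumes G: "self_adjoint_pos_def G" and "m \<le> DIM('a)"
  shows "\<exists>e. orthonormal_family G m e"
  using \<open>m \<le> DIM('a)\<close>
proof (induction m)
  case 0
  then show ?case by (simp add: orthonormal_family_def)
next
  case (Suc m)
  then obtain e where e: "orthonormal_family G m e" by auto
  have "dim (span (e ` {..<m})) \<le> card (e ` {..<m})"
    by (simp add: dim_le_card')
  also have "\<dots> \<le> m"
    using card_image_le[of "{..<m}" e] by simp
  finally have "dim (span (e ` {..<m})) \<noteq> dim (UNIV :: 'a set)"
    using Suc.prems by simp
  then have "span (e ` {..<m}) \<noteq> UNIV"
    by (rule contrapos_nn) (erule arg_cong)
  then obtain y where y: "y \<notin> span (e ` {..<m})" by auto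
  define z where "z = y - (\<Sum>i<m. G (e i) y *\<^sub>R e i)"
  have "(\<Sum>i<m. G (e i) y *\<^sub>R e i) \<in> span (e ` {..<m})"
    by (intro span_sum span_scale span_base) auto
  then have z0: "z \<noteq> 0" using y by (auto simp: z_def)
  have orth: "G (e j) z = 0" if "j < m" for j
  proof -
    have "G (e j) z = G (e j) y - (\<Sum>i<m. G (e i) y * G (e j) (e i))"
      by (simp add: z_def blinfun.bilinear_simps)
    also have "(\<Sum>i<m. G (e i) y * G (e j) (e i)) = (\<Sum>i<m. if j = i then G (e i) y else 0)"
      using e that by (intro sum.cong) (auto simp: orthonormal_family_def)
    finally show ?thesis using that by simp
  qed
  define u where "u = (1 / pnorm G z) *\<^sub>R z"
  have "G z z > 0" "pnorm G z > 0" "pnorm G z * pnorm G z = G z z"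
    using spd_pos[OF G z0] by (auto simp: pnorm_def)
  then have "G u u = 1"
    by (simp add: u_def blinfun.bilinear_simps field_simps)
  moreover have "G (e j) u = 0" "G u (e j) = 0" if "j < m" for j
    using orth[OF that] spd_sym[OF G, of z] by (simp_all add: u_def blinfun.bilinear_simps)
  ultimately have "orthonormal_family G (Suc m) (e(m := u))"
    using e by (auto simp: orthonormal_family_def less_Suc_eq)
  then show ?case by blast
qed

lemma orthonormal_family_span:
  fixes G :: "'a::euclidean_space \<Rightarrow>\<^sub>L 'a dual"
  assumes e: "orthonormal_family G DIM('a) e"
  shows "span (e ` {..<DIM('a)}) = UNIV"
proof -
  let ?S = "e ` {..<DIM('a)}"
  have inj: "inj_on e {..<DIM('a)}"
  proof (rule inj_onI)
    fix i j assume ij: "i \<in> {..<DIM('a)}" "j \<in> {..<DIM('a)}" "e i = e j"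
    have "G (e i) (e i) = of_bool (i = i)" "G (e i) (e j) = of_bool (i = j)"
      using e ij(1,2) unfolding orthonormal_family_def lessThan_iff by blast+
    with ij(3) show "i = j" by (cases "i = j") auto
  qed
  have "independent ?S"
  proof (rule independent_if_scalars_zero)
    fix f y assume f: "(\<Sum>z\<in>?S. f z *\<^sub>R z) = 0" and "y \<in> ?S"
    then obtain j where j: "j < DIM('a)" "y = e j" by auto
    have "0 = G (e j) (\<Sum>i<DIM('a). f (e i) *\<^sub>R e i)"
      using f by (simp add: sum.reindex[OF inj] blinfun.bilinear_simps)
    also have "\<dots> = (\<Sum>i<DIM('a). if j = i then f (e i) else 0)"
      unfolding blinfun.bilinear_simps
      using e j by (intro sum.cong) (auto simp: orthonormal_family_def)
    finally show "f y = 0" using j by simp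
  qed simp
  moreover have "card ?S = DIM('a)"
    using card_image[OF inj] by simp
  ultimately show ?thesis
    using card_ge_dim_independent[of ?S UNIV] by auto
qed

text \<open>The residual is orthogonal to every \<open>e j\<close>. These span the space, so the
  residual is orthogonal to itself and vanishes.\<close>

lemma orthonormal_family_expansion:
  fixes G :: "'a::euclidean_space \<Rightarrow>\<^sub>L 'a dual"
  assumes G: "self_adjoint_pos_def G" and e: "orthonormal_family G DIM('a) e"
  shows "y = (\<Sum>i<DIM('a). G (e i) y *\<^sub>R e i)"
proof -
  define r where "r = y - (\<Sum>i<DIM('a). G (e i) y *\<^sub>R e i)"
  have "G r (e j) = 0" if "j < DIM('a)" for j
  proof -
    have "G r (e j) = G (e j) y - (\<Sum>i<DIM('a). G (e i) y * G (e i) (e j))"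
      using spd_sym[OF G, of y "e j"] by (simp add: r_def blinfun.bilinear_simps)
    also have "(\<Sum>i<DIM('a). G (e i) y * G (e i) (e j))
        = (\<Sum>i<DIM('a). if j = i then G (e i) y else 0)"
      using e that by (intro sum.cong) (auto simp: orthonormal_family_def)
    finally show ?thesis using that by simp
  qed
  then have "G r r = 0"
    using orthonormal_family_span[OF e]
    by - (rule blinfun_eq_0_on_span[of "e ` {..<DIM('a)}"], auto)
  then have "r = 0" using spd_eq_0[OF G] by simp
  then show ?thesis by (simp add: r_def)
qed

lemma spd_represents:
  fixes G :: "'a::euclidean_space \<Rightarrow>\<^sub>L 'a dual"
  assumes G: "self_adjoint_pos_def G"
  obtains v where "G v = s"
proof -
  obtain e where e: "orthonormal_family G DIM('a) e"
    using ex_orthonormal_family[OF G] by blast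
  have "G (\<Sum>i<DIM('a). s (e i) *\<^sub>R e i) y = s y" for y
  proof -
    have "s y = s (\<Sum>i<DIM('a). G (e i) y *\<^sub>R e i)"
      using orthonormal_family_expansion[OF G e, of y] by simp
    then show ?thesis by (simp add: blinfun.bilinear_simps mult.commute)
  qed
  then show thesis using that blinfun_eqI by blast
qed

text \<open>\<open>dnorm\<close> is defined through \<open>inv\<close>, which is a genuine inverse
  because a definite form is injective. Together with \<open>spd_represents\<close> this lets every
  dual norm be computed from a representer \<open>v\<close>, without mentioning \<open>inv\<close>
  again.\<close>

lemma dnorm_eq_pnorm:
  assumes G: "self_adjoint_pos_def G" and v: "G v = s"
  shows "dnorm G s = pnorm G v"
proof -
  have "inj (blinfun_apply G)"
  proof (rule injI)
    fix x y assume "G x = G y"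
    then have "G (x - y) (x - y) = 0" by (simp add: blinfun.bilinear_simps)
    then show "x = y" using spd_eq_0[OF G, of "x - y"] by simp
  qed
  then have "inv (blinfun_apply G) s = v" using v inv_f_f by metis
  then show ?thesis using v by (simp add: dnorm_def pnorm_def)
qed

lemma dnorm_square:
  assumes G: "self_adjoint_pos_def G" and v: "G v = s"
  shows "(dnorm G s)\<^sup>2 = s v"
  using v by (simp add: dnorm_eq_pnorm[OF assms] pnorm_square[OF G])

lemma dnorm_pos:
  assumes G: "self_adjoint_pos_def G" and "s \<noteq> 0"
  shows "dnorm G s > 0"
proof -
  obtain v where v: "G v = s" using spd_represents[OF G] .
  with \<open>s \<noteq> 0\<close> have "v \<noteq> 0" by (auto simp: blinfun.bilinear_simps)
  then show ?thesis
    using spd_pos[OF G] by (simp add: dnorm_eq_pnorm[OF G v] pnorm_def)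
qed

lemma abs_le_dnorm_pnorm:
  fixes G :: "'a::euclidean_space \<Rightarrow>\<^sub>L 'a dual" and s :: "'a dual"
  assumes G: "self_adjoint_pos_def G"
  shows "\<bar>s y\<bar> \<le> dnorm G s * pnorm G y"
proof -
  obtain v where v: "G v = s" using spd_represents[OF G] .
  then show ?thesis
    using spd_Cauchy_Schwarz[OF G, of v y] by (simp add: dnorm_eq_pnorm[OF G v])
qed

lemma dnorm_square_orthonormal:
  fixes G :: "'a::euclidean_space \<Rightarrow>\<^sub>L 'a dual"
  assumes G: "self_adjoint_pos_def G" and e: "orthonormal_family G DIM('a) e"
  shows "(dnorm G s)\<^sup>2 = (\<Sum>i<DIM('a). (s (e i))\<^sup>2)"
proof -
  obtain v where v: "G v = s" using spd_represents[OF G] .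
  have "s v = s (\<Sum>i<DIM('a). G (e i) v *\<^sub>R e i)"
    using orthonormal_family_expansion[OF G e, of v] by simp
  then show ?thesis
    using v spd_sym[OF G, of _ v] unfolding dnorm_square[OF G v]
    by (simp add: blinfun.bilinear_simps power2_eq_square)
qed

text \<open>Compactness refers to the norm of the type class, which is unrelated to
  \<open>B\<close>. This comparison carries boundedness over from one norm to the other.\<close>

lemma norm_le_pnorm:
  fixes G :: "'a::euclidean_space \<Rightarrow>\<^sub>L 'a dual"
  assumes G: "self_adjoint_pos_def G"
  obtains C where "C \<ge> 0" "\<And>y. norm y \<le> C * pnorm G y"
proof -
  obtain e where e: "orthonormal_family G DIM('a) e"
    using ex_orthonormal_family[OF G] by blast
  have "norm y \<le> (\<Sum>i<DIM('a). norm (e i)) * pnorm G y" for y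
  proof -
    have "norm y = norm (\<Sum>i<DIM('a). G (e i) y *\<^sub>R e i)"
      using orthonormal_family_expansion[OF G e, of y] by simp
    also have "\<dots> \<le> (\<Sum>i<DIM('a). norm (G (e i) y *\<^sub>R e i))"
      by (rule norm_sum)
    also have "\<dots> \<le> (\<Sum>i<DIM('a). norm (e i) * pnorm G y)"
    proof (rule sum_mono)
      fix i assume "i \<in> {..<DIM('a)}"
      then have "pnorm G (e i) = 1"
        using e by (simp add: orthonormal_family_def pnorm_def)
      then show "norm (G (e i) y *\<^sub>R e i) \<le> norm (e i) * pnorm G y"
        using spd_Cauchy_Schwarz[OF G, of "e i" y]
        using mult_right_mono[of "\<bar>G (e i) y\<bar>" "pnorm G y" "norm (e i)"]
        by (simp add: mult.commute)
    qed
    finally show ?thesis by (simp add: sum_distrib_right)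
  qed
  then show thesis using that[of "\<Sum>i<DIM('a). norm (e i)"] by (simp add: sum_nonneg)
qed

lemma spd_rank_one_update:
  assumes "self_adjoint_pos_def G" "b \<ge> 0"
  shows "self_adjoint_pos_def (G + b *\<^sub>R rank_one s)"
proof -
  have "0 \<le> b * (s x * s x)" for x using \<open>b \<ge> 0\<close> by simp
  then show ?thesis
    using assms(1)
    by (simp add: self_adjoint_pos_def_def blinfun.bilinear_simps mult_ac add_pos_nonneg)
qed

section \<open>Determinant and trace of the accumulated Hessian\<close>

text \<open>The product of the values \<open>G (u j) (u j)\<close> over a Gram-Schmidt family of a \<open>B\<close>-orthonormal
  basis \<open>e\<close> plays the role of \<open>det (B\<^sup>-\<^sup>1 G)\<close>: it is the Gram determinant.\<close>

definition gram_schmidt ::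
  "('a::euclidean_space \<Rightarrow>\<^sub>L 'a dual) \<Rightarrow> nat \<Rightarrow> (nat \<Rightarrow> 'a) \<Rightarrow> (nat \<Rightarrow> 'a) \<Rightarrow> bool" where
  "gram_schmidt G n e u \<longleftrightarrow> (\<forall>j<n. u j - e j \<in> span (e ` {..<j}) \<and>
     (\<forall>y\<in>span (e ` {..<j}). G (u j) y = 0) \<and> G (u j) (u j) > 0)"

text \<open>The passage from \<open>e\<close> to \<open>u\<close> is unitriangular, so the two
  families generate the same flag of subspaces.\<close>

lemma gram_schmidt_span:
  assumes "gram_schmidt G n e u" and "m \<le> n"
  shows "span (u ` {..<m}) = span (e ` {..<m})"
  using \<open>m \<le> n\<close>
proof (induction m)
  case (Suc m)
  then have IH: "span (u ` {..<m}) = span (e ` {..<m})" by simp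
  have d: "u m - e m \<in> span (e ` {..<m})"
    using assms(1) Suc.prems by (simp add: gram_schmidt_def)
  have sub: "e ` {..<m} \<subseteq> e ` {..<Suc m}" "u ` {..<m} \<subseteq> u ` {..<Suc m}" by auto
  have "u j \<in> span (e ` {..<Suc m})" if "j < Suc m" for j
  proof (cases "j = m")
    case True
    have "e m \<in> span (e ` {..<Suc m})" "u m - e m \<in> span (e ` {..<Suc m})"
      using span_mono[OF sub(1)] d by (auto intro: span_base)
    from span_add[OF this] show ?thesis using True by simp
  next
    case False
    then have "u j \<in> span (u ` {..<m})" using that by (intro span_base) auto
    then show ?thesis using IH span_mono[OF sub(1)] by blast
  qed
  moreover have "e j \<in> span (u ` {..<Suc m})" if "j < Suc m" for j
  proof (cases "j = m")
    case True
    have "u m \<in> span (u ` {..<Suc m})" "u m - e m \<in> span (u ` {..<Suc m})"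
      using span_mono[OF sub(2)] d IH by (auto intro: span_base)
    from span_diff[OF this] show ?thesis using True by simp
  next
    case False
    then have "e j \<in> span (e ` {..<m})" using that by (intro span_base) auto
    then show ?thesis using IH span_mono[OF sub(2)] by blast
  qed
  ultimately show ?case
    unfolding span_eq by auto
qed simp

lemma gram_schmidt_orthogonal:
  assumes "gram_schmidt G n e u" "self_adjoint_pos_def G" "i < n" "j < n" "i \<noteq> j"
  shows "G (u i) (u j) = 0"
proof -
  have less: "G (u q) (u p) = 0" if "p < q" "q < n" for p q
  proof -
    have "u p \<in> span (u ` {..<q})" using that by (intro span_base) auto
    then have "u p \<in> span (e ` {..<q})"
      using gram_schmidt_span[OF assms(1), of q] that by auto
    then show ?thesis using assms(1) that by (simp add: gram_schmidt_def)
  qed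
  then show ?thesis
    using less[of i j] less[of j i] spd_sym[OF assms(2), of "u i"] assms(3-5)
    by (cases "i < j") auto
qed

text \<open>Both sides agree on each \<open>u j\<close> by orthogonality, and these span the
  subspace. The case \<open>m < n\<close> supplies the correction vectors of the rank-one update,
  the case \<open>m = n\<close> the dual norm.\<close>

lemma gram_schmidt_represents:
  fixes s :: "'a::euclidean_space dual"
  assumes gs: "gram_schmidt G n e u" and G: "self_adjoint_pos_def G" and "m \<le> n"
    and y: "y \<in> span (e ` {..<m})"
  shows "G (\<Sum>i<m. (s (u i) / G (u i) (u i)) *\<^sub>R u i) y = s y" (is "G ?v y = _")
proof -
  have *: "(G ?v - s) (u j) = 0" if "j < m" for j
  proof -
    have "G ?v (u j) = (\<Sum>i<m. (s (u i) / G (u i) (u i)) * G (u i) (u j))"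
      by (simp add: blinfun.bilinear_simps)
    also have "\<dots> = (\<Sum>i<m. if j = i then s (u i) else 0)"
    proof (intro sum.cong refl)
      fix i assume "i \<in> {..<m}"
      moreover from this have "G (u i) (u i) > 0"
        using gs \<open>m \<le> n\<close> by (simp add: gram_schmidt_def)
      ultimately show "(s (u i) / G (u i) (u i)) * G (u i) (u j) = (if j = i then s (u i) else 0)"
        using gram_schmidt_orthogonal[OF gs G, of i j] that \<open>m \<le> n\<close>
        by auto
    qed
    finally show ?thesis using that by (simp add: blinfun.bilinear_simps)
  qed
  have "(G ?v - s) y = 0"
    using y gram_schmidt_span[OF gs \<open>m \<le> n\<close>] *
    by - (rule blinfun_eq_0_on_span[of "u ` {..<m}"], auto)
  then show ?thesis by (simp add: blinfun.bilinear_simps)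
qed

text \<open>Hadamard's inequality. It holds factor by factor: \<open>e j\<close> is
  \<open>u j\<close> minus a vector orthogonal to \<open>u j\<close>, so Pythagoras applies.\<close>

lemma gram_schmidt_prod_le:
  assumes gs: "gram_schmidt G n e u" and G: "self_adjoint_pos_def G"
  shows "(\<Prod>j<n. G (u j) (u j)) \<le> (\<Prod>j<n. G (e j) (e j))"
proof (rule prod_mono)
  fix j assume "j \<in> {..<n}"
  then have j: "j < n" by simp
  define z where "z = u j - e j"
  have "z \<in> span (e ` {..<j})" "G (u j) z = 0"
    using gs j by (auto simp: gram_schmidt_def z_def)
  moreover have "e j = u j + (- z)" by (simp add: z_def)
  ultimately have "G (e j) (e j) = G (u j) (u j) + G z z"
    using spd_square_add[OF G, of "u j" "- z"] by (simp add: blinfun.bilinear_simps)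
  then show "0 \<le> G (u j) (u j) \<and> G (u j) (u j) \<le> G (e j) (e j)"
    using spd_nonneg[OF G] by simp
qed

text \<open>The matrix determinant lemma. Each \<open>u' j\<close> is corrected by a multiple of the representer \<open>v j\<close> of
  \<open>s\<close> on the span of the preceding vectors, and the quotients of the factors telescope.\<close>

lemma gram_schmidt_rank_one_update:
  fixes s :: "'a::euclidean_space dual"
  assumes gs: "gram_schmidt G n e u" and G: "self_adjoint_pos_def G" and b: "b \<ge> 0"
  defines "G' \<equiv> G + b *\<^sub>R rank_one s"
  shows "\<exists>u'. gram_schmidt G' n e u' \<and>
    (\<Prod>j<n. G' (u' j) (u' j)) =
    (1 + b * (\<Sum>i<n. (s (u i))\<^sup>2 / G (u i) (u i))) * (\<Prod>j<n. G (u j) (u j))"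
proof -
  define N where "N m = (\<Sum>i<m. (s (u i))\<^sup>2 / G (u i) (u i))" for m
  define v where "v m = (\<Sum>i<m. (s (u i) / G (u i) (u i)) *\<^sub>R u i)" for m
  \<comment> \<open>\<open>N j\<close> is the squared dual norm of \<open>s\<close> restricted to
    the span of the first \<open>j\<close> vectors. The coefficient c must satisfy c = b s(u' j), so
    that the contribution of the rank-one term cancels that of \<open>v j\<close> on this span.
    Since s(u' j) = s(u j) - c N j, the only solution is the one used here.\<close>
  define u' where "u' j = u j - (b * s (u j) / (1 + b * N j)) *\<^sub>R v j" for j
  have pos: "G (u j) (u j) > 0" if "j < n" for j
    using gs that by (simp add: gram_schmidt_def)
  have N: "1 + b * N j > 0" if "j \<le> n" for j
  proof -
    have "N j \<ge> 0"
      unfolding N_def using pos that by (intro sum_nonneg divide_nonneg_pos) auto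
    then show ?thesis using b by (simp add: add_pos_nonneg)
  qed
  have sv: "s (v j) = N j" for j
    by (simp add: v_def N_def blinfun.bilinear_simps power2_eq_square)
  have vspan: "v j \<in> span (e ` {..<j})" if "j \<le> n" for j
    unfolding v_def gram_schmidt_span[OF gs that, symmetric]
    by (intro span_sum span_scale span_base) auto
  have Gv: "G (v j) y = s y" if "j \<le> n" "y \<in> span (e ` {..<j})" for j y
    using gram_schmidt_represents[OF gs G that] by (simp add: v_def)
  have Gu: "G (u j) y = 0" if "j < n" "y \<in> span (e ` {..<j})" for j y
    using gs that by (simp add: gram_schmidt_def)
  have su': "s (u' j) = s (u j) / (1 + b * N j)" if "j < n" for j
    using N[of j] that by (simp add: u'_def blinfun.bilinear_simps sv field_simps)
  have orth: "G' (u' j) y = 0" if "j < n" "y \<in> span (e ` {..<j})" for j y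
    using that N[of j] Gu[OF that] Gv[of j y] su'[OF that(1)]
    by (simp add: G'_def blinfun.bilinear_simps) (simp add: u'_def blinfun.bilinear_simps)
  have G'u': "G' (u' j) (u' j) = G (u j) (u j) * ((1 + b * N (Suc j)) / (1 + b * N j))"
    if "j < n" for j
  proof -
    have "G' (u' j) (u' j) = G' (u' j) (u j) - (b * s (u j) / (1 + b * N j)) * G' (u' j) (v j)"
      by (subst (2) u'_def) (simp only: blinfun.bilinear_simps real_scaleR_def)
    also have "G' (u' j) (v j) = 0" using orth[OF that vspan] that by simp
    also have "G' (u' j) (u j) = G (u' j) (u j) + b * s (u' j) * s (u j)"
      by (simp add: G'_def blinfun.bilinear_simps)
    also have "G (u' j) (u j) = G (u j) (u j) - (b * s (u j) / (1 + b * N j)) * G (u j) (v j)"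
      using spd_sym[OF G, of "v j" "u j"] by (simp add: u'_def blinfun.bilinear_simps)
    also have "G (u j) (v j) = 0" using Gu[OF that vspan] that by simp
    finally have "G' (u' j) (u' j) = G (u j) (u j) + b * (s (u j))\<^sup>2 / (1 + b * N j)"
      using su'[OF that] by (simp add: power2_eq_square)
    also have "\<dots> = (G (u j) (u j) * (1 + b * N j) + b * (s (u j))\<^sup>2) / (1 + b * N j)"
      using N[of j] that by (simp add: field_simps)
    also have "G (u j) (u j) * (1 + b * N j) + b * (s (u j))\<^sup>2 = G (u j) (u j) * (1 + b * N (Suc j))"
      using pos[OF that] by (simp add: N_def distrib_left)
    finally show ?thesis by simp
  qed
  have "gram_schmidt G' n e u'"
    unfolding gram_schmidt_def
  proof (intro allI impI conjI ballI)
    fix j assume j: "j < n"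
    have "(u j - e j) - (b * s (u j) / (1 + b * N j)) *\<^sub>R v j \<in> span (e ` {..<j})"
      using gs j vspan[of j] 
      by (auto simp: gram_schmidt_def intro!: span_diff[of "u j - e j"] span_scale)
    then show "u' j - e j \<in> span (e ` {..<j})"
      by (simp add: u'_def algebra_simps)
    show "G' (u' j) (u' j) > 0"
      using G'u'[OF j] pos[OF j] N[of j] N[of "Suc j"] j by simp
  qed (use orth in blast)
  moreover have "(\<Prod>j<m. G' (u' j) (u' j)) = (1 + b * N m) * (\<Prod>j<m. G (u j) (u j))"
    if "m \<le> n" for m
    using that
  proof (induction m)
    case (Suc m)
    then show ?case
      using G'u'[of m] N[of m] by simp
  qed (simp add: N_def)
  ultimately show ?thesis unfolding N_def by blast
qed

lemma dnorm_square_gram_schmidt: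
  fixes s :: "'a::euclidean_space dual"
  assumes gs: "gram_schmidt G n e u" and G: "self_adjoint_pos_def G"
    and span: "span (e ` {..<n}) = UNIV"
  shows "(dnorm G s)\<^sup>2 = (\<Sum>i<n. (s (u i))\<^sup>2 / G (u i) (u i))"
proof -
  let ?v = "\<Sum>i<n. (s (u i) / G (u i) (u i)) *\<^sub>R u i"
  have "G ?v = s"
    using gram_schmidt_represents[OF gs G order_refl] span by (intro blinfun_eqI) auto
  from dnorm_square[OF G this] show ?thesis
    by (simp add: blinfun.bilinear_simps power2_eq_square)
qed

section \<open>Growth of the accumulated Hessian: determinant against trace\<close>

lemma hess_op_spd:
  assumes "self_adjoint_pos_def B" "\<And>k. b k \<ge> 0"
  shows "self_adjoint_pos_def (hess_op B b g k)"
  by (induction k) (simp_all add: assms spd_rank_one_update)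

lemma hess_op_ge:
  fixes B :: "'a::euclidean_space \<Rightarrow>\<^sub>L 'a dual"
  assumes "\<And>k. b k \<ge> 0"
  shows "B y y \<le> hess_op B b g k y y"
proof (induction k)
  case (Suc k)
  have "0 \<le> b k * (g k y * g k y)" using assms by simp
  with Suc show ?case by (simp add: blinfun.bilinear_simps)
qed simp

text \<open>The left side is the determinant: at the start \<open>e\<close> is its own Gram-Schmidt
  family with product 1, and each update contributes one factor. The family \<open>u\<close> changes
  with \<open>k\<close> while \<open>e\<close> does not. Hadamard's inequality replaces
  \<open>u\<close> by \<open>e\<close>, which leaves the diagonal entries whose sum is the
  trace.\<close>

lemma hess_op_prod_ge:
  fixes B :: "'a::euclidean_space \<Rightarrow>\<^sub>L 'a dual"
  assumes B: "self_adjoint_pos_def B" and b: "\<And>k. b k \<ge> 0"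
    and e: "orthonormal_family B DIM('a) e"
  shows "(\<Prod>i<k. 1 + b i * (dnorm (hess_op B b g i) (g i))\<^sup>2)
    \<le> (\<Prod>j<DIM('a). hess_op B b g k (e j) (e j))"
proof -
  let ?G = "hess_op B b g" and ?n = "DIM('a)"
  have "\<exists>u. gram_schmidt (?G k) ?n e u \<and>
      (\<Prod>j<?n. ?G k (u j) (u j)) = (\<Prod>i<k. 1 + b i * (dnorm (?G i) (g i))\<^sup>2)"
  proof (induction k)
    case 0
    have "gram_schmidt B ?n e e"
      unfolding gram_schmidt_def
    proof (intro allI impI conjI ballI)
      fix j y assume j: "j < ?n" and y: "y \<in> span (e ` {..<j})"
      then show "B (e j) y = 0"
        using e by - (rule blinfun_eq_0_on_span[of "e ` {..<j}"],
            auto simp: orthonormal_family_def)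
    qed (use e in \<open>auto simp: orthonormal_family_def span_zero\<close>)
    moreover have "(\<Prod>j<?n. B (e j) (e j)) = 1"
      using e by (intro prod.neutral) (auto simp: orthonormal_family_def)
    ultimately show ?case by auto
  next
    case (Suc k)
    then obtain u where u: "gram_schmidt (?G k) ?n e u"
      "(\<Prod>j<?n. ?G k (u j) (u j)) = (\<Prod>i<k. 1 + b i * (dnorm (?G i) (g i))\<^sup>2)" by blast
    note G = hess_op_spd[where g = g and b = b and k = k, OF B b]
    show ?case
      using gram_schmidt_rank_one_update[OF u(1) G b, of k "g k"]
      unfolding dnorm_square_gram_schmidt[OF u(1) G orthonormal_family_span[OF e], symmetric] u(2)
      by (simp add: mult.commute)
  qed
  then show ?thesis
    using gram_schmidt_prod_le hess_op_spd[where g = g and b = b and k = k, OF B b] by metis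
qed

text \<open>By Parseval, a rank-one term contributes its squared dual norm with respect to
  \<open>B\<close>.\<close>

lemma hess_op_trace:
  fixes B :: "'a::euclidean_space \<Rightarrow>\<^sub>L 'a dual"
  assumes B: "self_adjoint_pos_def B" and e: "orthonormal_family B DIM('a) e"
  shows "(\<Sum>j<DIM('a). hess_op B b g k (e j) (e j))
    = real DIM('a) + (\<Sum>i<k. b i * (dnorm B (g i))\<^sup>2)"
proof (induction k)
  case 0
  have "(\<Sum>j<DIM('a). B (e j) (e j)) = (\<Sum>j<DIM('a). 1)"
    using e by (intro sum.cong) (auto simp: orthonormal_family_def)
  then show ?case by simp
next
  case (Suc k)
  have "b k * (dnorm B (g k))\<^sup>2 = (\<Sum>j<DIM('a). b k * (g k (e j) * g k (e j)))"
    unfolding dnorm_square_orthonormal[OF B e]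
    by (simp add: sum_distrib_left power2_eq_square)
  with Suc show ?case
    by (simp add: blinfun.bilinear_simps sum.distrib mult.assoc)
qed

lemma prod_le_mean_power:
  fixes f :: "nat \<Rightarrow> real"
  assumes "\<And>i. i < n \<Longrightarrow> f i \<ge> 0" and "(\<Sum>i<n. f i) > 0"
  shows "(\<Prod>i<n. f i) \<le> ((\<Sum>i<n. f i) / real n) ^ n"
proof (cases "n = 0")
  case False
  define A where "A = (\<Sum>i<n. f i) / real n"
  have A: "A > 0" using assms(2) False by (simp add: A_def)
  \<comment> \<open>AM-GM from t <= exp (t - 1): after division by the mean the exponents add up to
    0.\<close>
  have "(\<Prod>i<n. f i / A) \<le> (\<Prod>i<n. exp (f i / A - 1))"
  proof (rule prod_mono)
    fix i assume "i \<in> {..<n}"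
    then show "0 \<le> f i / A \<and> f i / A \<le> exp (f i / A - 1)"
      using assms(1) A exp_ge_add_one_self[of "f i / A - 1"] by simp
  qed
  also have "\<dots> = exp ((\<Sum>i<n. f i) / A - real n)"
    by (simp add: exp_sum[symmetric] sum_subtractf sum_divide_distrib)
  also have "(\<Sum>i<n. f i) / A - real n = 0"
    using assms(2) False by (simp add: A_def)
  finally show ?thesis
    using A by (simp add: prod_dividef field_simps flip: A_def)
qed simp

lemma trace_lower_bound:
  fixes B :: "'a::euclidean_space \<Rightarrow>\<^sub>L 'a dual"
  assumes B: "self_adjoint_pos_def B" and b: "\<And>k. b k \<ge> 0"
    and step: "\<And>i. b i * (dnorm (hess_op B b g i) (g i))\<^sup>2 = \<gamma>"
  shows "exp (real k * ln (1 + \<gamma>) / real DIM('a)) \<le> 1 + (\<Sum>i<k. b i * (dnorm B (g i))\<^sup>2) / real DIM('a)"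
proof -
  obtain e where e: "orthonormal_family B DIM('a) e"
    using ex_orthonormal_family[OF B] by blast
  define T where "T = (\<Sum>i<k. b i * (dnorm B (g i))\<^sup>2)"
  have \<gamma>: "\<gamma> \<ge> 0" using step[of 0] b[of 0] by (metis mult_nonneg_nonneg zero_le_power2)
  have T: "T \<ge> 0" unfolding T_def using b by (intro sum_nonneg) simp
  \<comment> \<open>The n-th powers are compared, since that of the left side is exactly the
    determinant; the root is taken at the end.\<close>
  have "(exp (real k * ln (1 + \<gamma>) / real DIM('a))) ^ DIM('a) = (1 + \<gamma>) ^ k"
    using \<gamma> by (simp add: exp_of_nat_mult[symmetric]) (simp add: exp_of_nat_mult)
  also have "\<dots> = (\<Prod>i<k. 1 + b i * (dnorm (hess_op B b g i) (g i))\<^sup>2)"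
    by (simp add: step)
  also have "\<dots> \<le> (\<Prod>j<DIM('a). hess_op B b g k (e j) (e j))"
    by (rule hess_op_prod_ge[OF B b e])
  also have "\<dots> \<le> ((real DIM('a) + T) / real DIM('a)) ^ DIM('a)"
    using prod_le_mean_power[of "DIM('a)" "\<lambda>j. hess_op B b g k (e j) (e j)"]
      spd_nonneg[OF hess_op_spd[where g = g and b = b and k = k, OF B b]] T
    by (simp add: hess_op_trace[OF B e] flip: T_def) (simp add: add_pos_nonneg)
  finally have "exp (real k * ln (1 + \<gamma>) / real DIM('a)) \<le> (real DIM('a) + T) / real DIM('a)"
    using T by (subst (asm) power_mono_iff) auto
  then show ?thesis by (simp add: add_divide_distrib flip: T_def)
qed

section \<open>The rate constants\<close>

lemma ln_ratio_ge:
  fixes s :: real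
  assumes "0 \<le> s" "s < 1"
  shows "ln (1 + s) - ln (1 - s) \<ge> 2 * s"
proof -
  have "ln (1 + 0) - ln (1 - 0) - 2 * 0 \<le> ln (1 + s) - ln (1 - s) - 2 * s"
  proof (rule DERIV_nonneg_imp_nondecreasing[OF \<open>0 \<le> s\<close>])
    fix t assume t: "0 \<le> t" "t \<le> s"
    then have "t < 1" using assms by simp
    then have "1 - t * t > 0" using t mult_strict_mono[of t 1 t 1] by simp
    have "((\<lambda>s. ln (1 + s) - ln (1 - s) - 2 * s) has_real_derivative
        1 / (1 + t) + 1 / (1 - t) - 2) (at t)"
      using t \<open>t < 1\<close> by (auto intro!: derivative_eq_intros)
    moreover have "1 / (1 + t) + 1 / (1 - t) - 2 = 2 * (t * t) / ((1 + t) * (1 - t))"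
      using t \<open>t < 1\<close> \<open>1 - t * t > 0\<close> by (simp add: field_simps)
    moreover have "\<dots> \<ge> 0"
      using t \<open>t < 1\<close> by (intro divide_nonneg_nonneg mult_nonneg_nonneg) auto
    ultimately show "\<exists>y. ((\<lambda>s. ln (1 + s) - ln (1 - s) - 2 * s) has_real_derivative y) (at t) \<and> 0 \<le> y"
      by metis
  qed
  then show ?thesis by simp
qed

text \<open>The difference of the two sides vanishes at 0, and its derivative is the difference of
  the two sides in \<open>ln_ratio_ge\<close>.\<close>

lemma binary_entropy_ge:
  fixes s :: real
  assumes "0 \<le> s" "s < 1"
  shows "(1 + s) * ln (1 + s) + (1 - s) * ln (1 - s) \<ge> s\<^sup>2"
proof -
  let ?f = "\<lambda>s::real. (1 + s) * ln (1 + s) + (1 - s) * ln (1 - s) - s\<^sup>2"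
  have "?f 0 \<le> ?f s"
  proof (rule DERIV_nonneg_imp_nondecreasing[OF \<open>0 \<le> s\<close>])
    fix t assume t: "0 \<le> t" "t \<le> s"
    then have "t < 1" using assms by simp
    have "(?f has_real_derivative ln (1 + t) - ln (1 - t) - 2 * t) (at t)"
      using t \<open>t < 1\<close> by (auto intro!: derivative_eq_intros)
    with ln_ratio_ge[of t] t \<open>t < 1\<close>
    show "\<exists>y. (?f has_real_derivative y) (at t) \<and> 0 \<le> y" by auto
  qed
  then show ?thesis by simp
qed

lemma rate_constants:
  fixes n :: nat and \<gamma> :: real
  assumes "n \<ge> 1" and \<gamma>_def: "\<gamma> = 2 / (sqrt (4 * (real n)\<^sup>2 - 1) + 2 * real n - 1)"
  defines "q \<equiv> 1 + \<gamma>\<^sup>2 / (2 * (1 + \<gamma>))"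
  shows "\<gamma> > 0" and "\<gamma> * n \<ge> 1 / 2" and "ln (1 + \<gamma>) \<ge> 1 / (2 * real n)"
    and "ln q \<le> ln (1 + \<gamma>) / (2 * real n) - 1 / (8 * (real n)\<^sup>2)"
    and "ln q \<le> 1 / (6 * (real n)\<^sup>2)"
proof -
  define s where "s = 1 / (2 * real n)"
  have n: "real n \<ge> 1" using \<open>n \<ge> 1\<close> by simp
  then have s: "0 < s" "s \<le> 1 / 2" by (auto simp: s_def field_simps)
  then have s_sq: "3 / 4 \<le> 1 - s\<^sup>2"
    using power_mono[OF s(2), of 2] by (simp add: power2_eq_square)
  have n_sq: "(real n)\<^sup>2 \<ge> 1" using n by simp
  define r where "r = sqrt (4 * (real n)\<^sup>2 - 1)"
  have r: "r > 0" "r * r = (2 * real n - 1) * (2 * real n + 1)"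
    using n_sq by (auto simp: r_def algebra_simps power2_eq_square)
  show \<gamma>: "\<gamma> > 0" using r n by (simp add: \<gamma>_def flip: r_def)
  have "1 + \<gamma> = (r + 2 * real n + 1) / (r + 2 * real n - 1)"
    using r n by (simp add: \<gamma>_def field_simps flip: r_def)
  \<comment> \<open>Cross-multiplying, both sides become r^2 + r (2n - 1), because r^2 = (2n - 1)(2n
    + 1).\<close>
  also have "\<dots> = r / (2 * real n - 1)"
    using r n by (simp add: frac_eq_eq) (simp add: algebra_simps)
  finally have "(1 + \<gamma>)\<^sup>2 = (2 * real n + 1) / (2 * real n - 1)"
    using r n by (simp add: power2_eq_square)
  also have "\<dots> = (1 + s) / (1 - s)"
    using n by (simp add: s_def field_simps)
  finally have p: "(1 + \<gamma>)\<^sup>2 = (1 + s) / (1 - s)" .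
  have "2 * ln (1 + \<gamma>) = ln ((1 + \<gamma>)\<^sup>2)"
    using \<gamma> by (simp add: ln_realpow)
  also have "\<dots> = ln (1 + s) - ln (1 - s)"
    unfolding p using s by (simp add: ln_div)
  finally have L: "2 * ln (1 + \<gamma>) = ln (1 + s) - ln (1 - s)" .
  then have L_ge: "ln (1 + \<gamma>) \<ge> s" using ln_ratio_ge[of s] s by simp
  then show "ln (1 + \<gamma>) \<ge> 1 / (2 * real n)" by (simp add: s_def)
  have "s \<le> \<gamma>" using L_ge ln_add_one_self_le_self[of \<gamma>] \<gamma> by linarith
  then show "\<gamma> * n \<ge> 1 / 2" using n by (simp add: s_def field_simps)
  have "q = ((1 + \<gamma>)\<^sup>2 + 1) / (2 * (1 + \<gamma>))"
    using \<gamma> by (simp add: q_def field_simps power2_eq_square)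
  then have "q\<^sup>2 = ((1 + \<gamma>)\<^sup>2 + 1)\<^sup>2 / (4 * (1 + \<gamma>)\<^sup>2)"
    by (simp only: power_divide power_mult_distrib) simp
  also have "\<dots> = 1 / ((1 - s) * (1 + s))"
  proof -
    have quot: "(2 / d)\<^sup>2 / (4 * (e / d)) = 1 / (d * e)" if "d > 0" "e > 0" for d e :: real
      using that by (simp add: field_simps power2_eq_square)
    have "(1 + s) / (1 - s) + 1 = 2 / (1 - s)" using s by (simp add: field_simps)
    then show ?thesis unfolding p by (simp only:) (rule quot, use s in auto)
  qed
  finally have q_sq: "q\<^sup>2 = 1 / ((1 - s) * (1 + s))" .
  have q: "q > 0" using \<gamma> by (simp add: q_def add_pos_nonneg)
  have "2 * ln q = ln (q\<^sup>2)" using q by (simp add: ln_realpow)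
  also have "\<dots> = - (ln (1 - s) + ln (1 + s))"
    unfolding q_sq using s by (simp add: ln_div ln_mult)
  finally have ln_q: "2 * ln q = - (ln (1 - s) + ln (1 + s))" .
  \<comment> \<open>By \<open>ln_q\<close> and \<open>L\<close>, the difference of 2 s ln (1 +
    \<gamma>) and 2 ln q is exactly the left side of \<open>binary_entropy_ge\<close>.\<close>
  have "2 * ln q \<le> s * (2 * ln (1 + \<gamma>)) - s\<^sup>2"
    using binary_entropy_ge[of s] s unfolding ln_q L by (simp add: algebra_simps)
  then show "ln q \<le> ln (1 + \<gamma>) / (2 * real n) - 1 / (8 * (real n)\<^sup>2)"
    by (simp add: s_def field_simps power2_eq_square)
  have "2 * ln q = ln (q\<^sup>2)" using q by (simp add: ln_realpow)
  also have "\<dots> \<le> q\<^sup>2 - 1" using q by (intro ln_le_minus_one) simp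
  also have "\<dots> = s\<^sup>2 / (1 - s\<^sup>2)"
    unfolding q_sq using s s_sq by (simp add: field_simps power2_eq_square)
  \<comment> \<open>The bound 3/4 is the value of 1 - s^2 at the worst case n = 1.\<close>
  also have "\<dots> \<le> s\<^sup>2 / (3 / 4)"
  proof (rule divide_left_mono)
    show "3 / 4 \<le> 1 - s\<^sup>2" by (rule s_sq)
    then show "0 < (1 - s\<^sup>2) * (3 / 4)" by simp
  qed simp
  finally show "ln q \<le> 1 / (6 * (real n)\<^sup>2)"
    by (simp add: s_def field_simps power2_eq_square)
qed

section \<open>The localization sets\<close>

text \<open>Here \<gamma> is any positive number and \<open>xs\<close> a fixed solution. The
  estimates that depend on the special value of \<gamma> enter as hypotheses of
  \<open>Gamma_ge\<close> and \<open>gap_le\<close>, to be discharged by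
  \<open>rate_constants\<close>.\<close>

locale subgradient_ellipsoid_run =
  fixes B :: "'a::euclidean_space \<Rightarrow>\<^sub>L 'a dual"
    and Or :: "'a \<Rightarrow> 'a dual"
    and x0 xs :: 'a
    and R \<theta> \<gamma> :: real
    and a b U :: "nat \<Rightarrow> real"
    and x :: "nat \<Rightarrow> 'a"
    and g :: "nat \<Rightarrow> 'a dual"
    and l w :: "nat \<Rightarrow> 'a \<Rightarrow> real"
  assumes B: "self_adjoint_pos_def B"
    and R: "R > 0"
    and xs: "pnorm B (xs - x0) \<le> R"
    and solution: "\<And>y. Or y (y - xs) \<ge> 0"
    and \<theta>: "\<theta> = sqrt 2 - 1"
    and \<gamma>: "\<gamma> > 0"
    and scheme: "general_scheme B Or x0 R a b x g U l w"
    and a_def: "\<And>k. a k = (1/2 * \<theta> * \<gamma> * radius B R a b g U k) / dnorm (hess_op B b g k) (g k)"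
    and b_def: "\<And>k. b k = \<gamma> / (dnorm (hess_op B b g k) (g k))\<^sup>2"
    and g_nz: "\<And>k. g k \<noteq> 0"
begin

abbreviation "H k \<equiv> hess_op B b g k"
abbreviation "\<nu> k \<equiv> dnorm (H k) (g k)"
abbreviation "r k \<equiv> radius B R a b g U k"
abbreviation "q \<equiv> 1 + \<gamma>\<^sup>2 / (2 * (1 + \<gamma>))"

lemma
  shows x_0: "x 0 = x0" and l_0: "l 0 y = 0"
    and w_0: "w 0 y = 1/2 * (pnorm B (y - x0))\<^sup>2"
    and a_nonneg: "a k \<ge> 0" and b_nonneg: "b k \<ge> 0" and g_eq: "g k = Or (x k)"
    and U_max: "is_maximum (\<lambda>y. g k (x k - y)) (Omega_set R (w k) \<inter> {y. l k y \<le> 0}) (U k)"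
    and l_Suc: "l (Suc k) y = l k y + a k * g k (y - x k)"
    and w_Suc: "w (Suc k) y = w k y + 1/2 * b k * (U k + g k (y - x k)) * g k (y - x k)"
    and argmin: "l (Suc k) (x (Suc k)) + w (Suc k) (x (Suc k)) \<le> l (Suc k) y + w (Suc k) y"
proof -
  note run = scheme[unfolded general_scheme_def]
  show "x 0 = x0" "l 0 y = 0" "w 0 y = 1/2 * (pnorm B (y - x0))\<^sup>2"
    using run by auto
  show "a k \<ge> 0" "b k \<ge> 0" "g k = Or (x k)"
    "is_maximum (\<lambda>y. g k (x k - y)) (Omega_set R (w k) \<inter> {y. l k y \<le> 0}) (U k)"
    using run by blast+
  show "l (Suc k) y = l k y + a k * g k (y - x k)"
    using run by simp
  have "g k (x k - y) = - g k (y - x k)"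
    by (simp add: blinfun.bilinear_simps)
  with run show "w (Suc k) y = w k y + 1/2 * b k * (U k + g k (y - x k)) * g k (y - x k)"
    by simp
  have "is_arg_min (\<lambda>y. l (Suc k) y + w (Suc k) y) (\<lambda>y. True) (x (Suc k))"
    using run by blast
  then show "l (Suc k) (x (Suc k)) + w (Suc k) (x (Suc k)) \<le> l (Suc k) y + w (Suc k) y"
    by (simp add: is_arg_min_def not_less)
qed

lemma H_spd: "self_adjoint_pos_def (H k)"
  by (rule hess_op_spd[OF B b_nonneg])

lemma \<nu>_pos: "\<nu> k > 0"
  by (rule dnorm_pos[OF H_spd g_nz])

lemma b_\<nu>: "b k * (\<nu> k)\<^sup>2 = \<gamma>"
  using \<nu>_pos[of k] by (subst b_def) simp

lemma r_Suc_square: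
  "(r (Suc k))\<^sup>2 = (r k)\<^sup>2 + (a k + 1/2 * b k * U k)\<^sup>2 * ((\<nu> k)\<^sup>2 / (1 + b k * (\<nu> k)\<^sup>2))"
  by (simp add: b_nonneg add_nonneg_nonneg)

lemma r_le_Suc: "r k \<le> r (Suc k)"
proof (rule power2_le_imp_le)
  show "(r k)\<^sup>2 \<le> (r (Suc k))\<^sup>2"
    unfolding r_Suc_square using b_nonneg[of k] by simp
qed (simp add: b_nonneg add_nonneg_nonneg)

lemma r_mono: "i \<le> k \<Longrightarrow> r i \<le> r k"
  by (rule lift_Suc_mono_le[of r]) (rule r_le_Suc)

lemma r_ge: "r k \<ge> R"
  using r_mono[of 0 k] by simp

text \<open>Completing the square. With h = y - x_k and c = a_k + b_k U_k / 2, a step adds c g_k(h)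
  + b_k g_k(h)^2 / 2. The quadratic part updates the Hessian, and the linear part lowers the minimum
  by exactly half the increment in the recursion of \<open>radius\<close>.\<close>

lemma potential_eq:
  "l k y + w k y = (R\<^sup>2 - (r k)\<^sup>2) / 2 + 1/2 * H k (y - x k) (y - x k)"
proof (induction k arbitrary: y)
  case 0
  then show ?case by (simp add: l_0 w_0 x_0 pnorm_square[OF B])
next
  case (Suc k)
  define c where "c = a k + 1/2 * b k * U k"
  obtain v where v: "H k v = g k" using spd_represents[OF H_spd] .
  have \<nu>2: "(\<nu> k)\<^sup>2 = g k v" by (rule dnorm_square[OF H_spd v])
  define t where "t = c / (1 + \<gamma>)"
  \<comment> \<open>The new minimizer: \<open>H (Suc k)\<close> maps \<open>v\<close> to (1 +
    \<gamma>) times \<open>g k\<close>, so it maps \<open>t *\<^sub>R v\<close> to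
    \<open>c *\<^sub>R g k\<close>, which balances the linear term.\<close>
  define z where "z = x k - t *\<^sub>R v"
  have Hv: "H (Suc k) y v = (1 + \<gamma>) * g k y" for y
    using spd_sym[OF H_spd, of k y v] v b_\<nu>[of k]
    by (simp add: blinfun.bilinear_simps \<nu>2 algebra_simps)
  have step: "l (Suc k) y + w (Suc k) y
      = (R\<^sup>2 - (r (Suc k))\<^sup>2) / 2 + 1/2 * H (Suc k) (y - z) (y - z)" for y
  proof -
    have "l (Suc k) y + w (Suc k) y
        = (R\<^sup>2 - (r k)\<^sup>2) / 2 + 1/2 * H (Suc k) (y - x k) (y - x k) + c * g k (y - x k)"
    proof -
      have "H (Suc k) h h = H k h h + b k * (g k h * g k h)" for h
        by (simp add: blinfun.bilinear_simps)
      from this[of "y - x k"] Suc.IH[of y] show ?thesis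
        unfolding l_Suc w_Suc c_def by (simp only: algebra_simps)
    qed
    also have "y - x k = (y - z) + (- t) *\<^sub>R v"
      by (simp add: z_def)
    also have "H (Suc k) ((y - z) + (- t) *\<^sub>R v) ((y - z) + (- t) *\<^sub>R v)
        = H (Suc k) (y - z) (y - z) - 2 * t * H (Suc k) (y - z) v + t\<^sup>2 * H (Suc k) v v"
      unfolding spd_square_add[OF H_spd]
      by (simp only: blinfun.scaleR_left blinfun.scaleR_right scaleR_blinfun.rep_eq)
        (simp add: power2_eq_square)
    also have "\<dots> = H (Suc k) (y - z) (y - z) - 2 * c * g k (y - z) + t * c * g k v"
      using \<gamma> unfolding Hv by (simp add: t_def power2_eq_square)
    also have "g k ((y - z) + (- t) *\<^sub>R v) = g k (y - z) - t * g k v"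
      by (simp add: blinfun.bilinear_simps)
    finally have "l (Suc k) y + w (Suc k) y
        = (R\<^sup>2 - (r k)\<^sup>2) / 2
          + 1/2 * (H (Suc k) (y - z) (y - z) - 2 * c * g k (y - z) + t * c * g k v)
          + c * (g k (y - z) - t * g k v)" .
    moreover have "(R\<^sup>2 - (r (Suc k))\<^sup>2) / 2 = (R\<^sup>2 - (r k)\<^sup>2) / 2 - 1/2 * (t * c * g k v)"
      using b_\<nu>[of k] \<gamma> unfolding r_Suc_square \<nu>2 c_def[symmetric]
      by (simp add: t_def field_simps power2_eq_square)
    moreover have "P + 1/2 * (X - 2 * c * Y + t * c * Z) + c * (Y - t * Z)
        = (P - 1/2 * (t * c * Z)) + 1/2 * X" for P X Y Z
      by (simp add: algebra_simps)
    ultimately show ?thesis by (simp only:)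
  qed
  have "H (Suc k) (x (Suc k) - z) (x (Suc k) - z) \<le> H (Suc k) (z - z) (z - z)"
    using argmin[of k z] unfolding step by linarith
  then have "x (Suc k) - z = 0"
    using spd_eq_0[OF H_spd] by (simp only: diff_self blinfun.zero_right)
  then show ?case using step by simp
qed

text \<open>With t = g_k(x_k - xs), the oracle gives t >= 0. Membership of \<open>xs\<close> at step
  \<open>k\<close> makes it a competitor for the maximum, so t <= U_k. Hence the increments -a_k t
  and -b_k (U_k - t) t / 2 are both nonpositive. The bound t <= U_k needs both conditions, hence the
  joint induction.\<close>

lemma solution_localized: "w k xs \<le> 1/2 * R\<^sup>2 \<and> l k xs \<le> 0"
proof (induction k)
  case 0
  have "(pnorm B (xs - x0))\<^sup>2 \<le> R\<^sup>2"
    using xs pnorm_nonneg[OF B] by (simp add: power_mono)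
  then show ?case by (simp add: w_0 l_0)
next
  case (Suc k)
  have le: "g k (x k - xs) \<le> U k"
    using U_max[of k] Suc by (simp add: is_maximum_def Omega_set_def)
  have "g k (x k - xs) \<ge> 0" using solution[of "x k"] by (simp add: g_eq)
  with le have "g k (xs - x k) \<le> 0" "U k + g k (xs - x k) \<ge> 0"
    by (simp_all add: blinfun.bilinear_simps)
  then have "a k * g k (xs - x k) \<le> 0"
    "1/2 * b k * (U k + g k (xs - x k)) * g k (xs - x k) \<le> 0"
    using a_nonneg[of k] b_nonneg[of k] by (auto intro!: mult_nonneg_nonpos)
  with Suc show ?case by (simp only: l_Suc w_Suc) linarith
qed

lemma localization_ball:
  assumes "w k y \<le> 1/2 * R\<^sup>2" and "l k y \<le> 0"
  shows "pnorm (H k) (y - x k) \<le> r k"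
proof (rule power2_le_imp_le)
  show "(pnorm (H k) (y - x k))\<^sup>2 \<le> (r k)\<^sup>2"
    using potential_eq[of k y] assms unfolding pnorm_square[OF H_spd] by (simp add: field_simps)
qed (use r_ge[of k] R in linarith)

lemma U_nonneg: "U k \<ge> 0"
proof -
  have "g k (x k - xs) \<le> U k"
    using U_max[of k] solution_localized[of k] by (simp add: is_maximum_def Omega_set_def)
  moreover have "g k (x k - xs) \<ge> 0" using solution[of "x k"] by (simp add: g_eq)
  ultimately show ?thesis by simp
qed

lemma U_le: "U k \<le> \<nu> k * r k"
proof -
  obtain y where y: "w k y \<le> 1/2 * R\<^sup>2" "l k y \<le> 0" "g k (x k - y) = U k"
    using U_max[of k] by (auto simp: is_maximum_def Omega_set_def)
  have "U k \<le> \<nu> k * pnorm (H k) (x k - y)"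
    using abs_le_dnorm_pnorm[OF H_spd, of "g k" "x k - y" k] y by linarith
  also have "\<dots> \<le> \<nu> k * r k"
    using localization_ball[OF y(1,2)] \<nu>_pos[of k]
    by (simp add: pnorm_commute[of _ "x k"])
  finally show ?thesis .
qed

lemma r_Suc_le: "(r (Suc k))\<^sup>2 \<le> q * (r k)\<^sup>2"
proof -
  have "b k * U k \<le> b k * (\<nu> k * r k)"
    using U_le[of k] b_nonneg[of k] by (rule mult_left_mono)
  also have "b k * (\<nu> k * r k) = \<gamma> * r k / \<nu> k"
    using \<nu>_pos[of k] by (subst b_def) (simp add: power2_eq_square)
  finally have "a k + 1/2 * b k * U k \<le> (1/2 * \<gamma> * r k / \<nu> k) * (\<theta> + 1)"
    using \<nu>_pos[of k] by (subst a_def) (simp add: field_simps)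
  then have "(a k + 1/2 * b k * U k)\<^sup>2 \<le> ((1/2 * \<gamma> * r k / \<nu> k) * (\<theta> + 1))\<^sup>2"
    using a_nonneg[of k] b_nonneg[of k] U_nonneg[of k] by (intro power_mono) auto
  \<comment> \<open>Here \<theta> + 1 = sqrt 2, so the factor 1/4 from squaring becomes 1/2.\<close>
  also have "\<dots> = 1/2 * \<gamma>\<^sup>2 * (r k)\<^sup>2 / (\<nu> k)\<^sup>2"
    by (simp add: \<theta> power_mult_distrib power_divide)
  finally have "(a k + 1/2 * b k * U k)\<^sup>2 * ((\<nu> k)\<^sup>2 / (1 + \<gamma>))
      \<le> (1/2 * \<gamma>\<^sup>2 * (r k)\<^sup>2 / (\<nu> k)\<^sup>2) * ((\<nu> k)\<^sup>2 / (1 + \<gamma>))"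
    using \<gamma> by (intro mult_right_mono) auto
  also have "\<dots> = \<gamma>\<^sup>2 / (2 * (1 + \<gamma>)) * (r k)\<^sup>2"
  proof -
    have "(1/2 * A * C / N) * (N / D) = A / (2 * D) * C" if "N \<noteq> 0" for A C D N :: real
      using that by simp
    then show ?thesis using \<nu>_pos[of k] by simp
  qed
  finally show ?thesis
    unfolding r_Suc_square b_\<nu> by (simp add: distrib_right)
qed

lemma r_square_le: "(r k)\<^sup>2 \<le> exp (k * ln q) * R\<^sup>2"
proof (induction k)
  case (Suc k)
  have q: "q > 0" using \<gamma> by (simp add: add_pos_nonneg)
  have "(r (Suc k))\<^sup>2 \<le> q * (exp (k * ln q) * R\<^sup>2)"
    using r_Suc_le[of k] mult_left_mono[OF Suc, of q] q by linarith
  also have "\<dots> = exp (Suc k * ln q) * R\<^sup>2"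
    using q by (simp add: exp_add distrib_right)
  finally show ?case .
qed simp

section \<open>Compactness of the sets over which the gap is maximized\<close>

lemma w_lower_bound: "\<exists>c. \<forall>y. w k y \<ge> 1/2 * (pnorm B (y - x0))\<^sup>2 - c"
proof (induction k)
  case 0
  show ?case by (intro exI[of _ 0]) (simp add: w_0)
next
  case (Suc k)
  then obtain c where c: "\<And>y. w k y \<ge> 1/2 * (pnorm B (y - x0))\<^sup>2 - c" by blast
  have "w (Suc k) y \<ge> 1/2 * (pnorm B (y - x0))\<^sup>2 - (c + b k * (U k)\<^sup>2 / 8)" for y
  proof -
    \<comment> \<open>The added term is negative between the two roots of the cut, but completing
      the square shows that it never falls below -b_k U_k^2 / 8.\<close>
    have "0 \<le> b k / 2 * (g k (y - x k) + U k / 2)\<^sup>2"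
      using b_nonneg[of k] by simp
    then show ?thesis
      using c[of y] by (simp add: w_Suc power2_eq_square field_simps)
  qed
  then show ?case by blast
qed

lemma continuous_on_l: "continuous_on S (l k)"
proof (induction k)
  case (Suc k)
  then show ?case unfolding l_Suc[abs_def] by (intro continuous_intros)
qed (simp add: l_0[abs_def])

lemma continuous_on_w: "continuous_on S (w k)"
proof (induction k)
  case 0
  show ?case
    unfolding w_0[abs_def] pnorm_square[OF B] by (intro continuous_intros)
next
  case (Suc k)
  then show ?case unfolding w_Suc[abs_def] by (intro continuous_intros)
qed

text \<open>\<open>is_maximum\<close> demands that the maximum be attained, so the existence of the
  sliding gap is part of what has to be proved.\<close>

lemma compact_Omega: "compact (Omega_set R (w k))"
proof -
  obtain c where c: "\<And>y. w k y \<ge> 1/2 * (pnorm B (y - x0))\<^sup>2 - c"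
    using w_lower_bound by blast
  obtain C where C: "C \<ge> 0" "\<And>y. norm y \<le> C * pnorm B y"
    using norm_le_pnorm[OF B] by blast
  have "norm y \<le> C * sqrt (R\<^sup>2 + 2 * c) + norm x0" if "y \<in> Omega_set R (w k)" for y
  proof -
    have "(pnorm B (y - x0))\<^sup>2 \<le> R\<^sup>2 + 2 * c"
      using that c[of y] by (simp add: Omega_set_def)
    then have "pnorm B (y - x0) \<le> sqrt (R\<^sup>2 + 2 * c)"
      by (rule real_le_rsqrt)
    then have "norm (y - x0) \<le> C * sqrt (R\<^sup>2 + 2 * c)"
      using C mult_left_mono order_trans by blast
    then show ?thesis using norm_triangle_ineq2[of y x0] by linarith
  qed
  then have "bounded (Omega_set R (w k))" by (auto simp: bounded_iff)
  moreover have "closed (Omega_set R (w k))"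
    unfolding Omega_set_def using continuous_on_w by (intro closed_Collect_le) auto
  ultimately show ?thesis by (simp add: compact_eq_bounded_closed)
qed

section \<open>The sliding gap\<close>

lemma Gamma_pos: "k \<ge> 1 \<Longrightarrow> Gamma_sum B a g k > 0"
proof -
  assume k: "k \<ge> 1"
  have "a i * dnorm B (g i) > 0" for i
    using dnorm_pos[OF B g_nz, of i] \<nu>_pos[of i] r_ge[of i] R \<gamma>
    by (subst a_def) (simp add: \<theta>)
  then show ?thesis using k unfolding Gamma_sum_def by (intro sum_pos) (auto simp: lessThan_empty_iff)
qed

lemma l_eq_sum: "l k y = (\<Sum>i<k. a i * g i (y - x i))"
  by (induction k) (simp_all add: l_0 l_Suc)

lemma pnorm_B_le: "pnorm B y \<le> pnorm (H k) y"
  unfolding pnorm_def using hess_op_ge[OF b_nonneg] by (intro real_sqrt_le_mono)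

lemma neg_l_le_radius: "w k y \<le> 1/2 * R\<^sup>2 \<Longrightarrow> - l k y \<le> 1/2 * (r k)\<^sup>2"
  using potential_eq[of k y] spd_nonneg[OF H_spd, of k "y - x k"] by (simp add: field_simps)

text \<open>The distance from \<open>x i\<close> to \<open>y\<close> is estimated along the path
  \<open>x i\<close>, \<open>xs\<close>, \<open>x k\<close>, \<open>y\<close>. The solution lies in
  all localizers and \<open>y\<close> in the \<open>k\<close>-th one, so the three legs are at most
  \<open>r i\<close>, \<open>r k\<close> and \<open>r k\<close>.\<close>

lemma neg_l_le_Gamma:
  assumes "w k y \<le> 1/2 * R\<^sup>2" "l k y \<le> 0"
  shows "- l k y \<le> Gamma_sum B a g k * (3 * r k)"
proof -
  have ball: "pnorm B (y - x i) \<le> r i" if "w i y \<le> 1/2 * R\<^sup>2" "l i y \<le> 0" for y i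
    using localization_ball[OF that] pnorm_B_le order_trans by blast
  have "- l k y = (\<Sum>i<k. a i * g i (x i - y))"
    by (simp add: l_eq_sum blinfun.bilinear_simps algebra_simps flip: sum_negf)
  also have "\<dots> \<le> (\<Sum>i<k. a i * dnorm B (g i) * (3 * r k))"
  proof (rule sum_mono)
    fix i assume "i \<in> {..<k}"
    then have "r i \<le> r k" by (intro r_mono) simp
    have "pnorm B (x i - y) \<le> pnorm B (x i - xs) + pnorm B ((xs - x k) + (x k - y))"
      using pnorm_triangle[OF B, of "x i - xs" "(xs - x k) + (x k - y)"] by simp
    also have "\<dots> \<le> pnorm B (x i - xs) + pnorm B (xs - x k) + pnorm B (x k - y)"
      using pnorm_triangle[OF B, of "xs - x k" "x k - y"] by simp
    also have "\<dots> \<le> 3 * r k"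
      using ball[of i xs] ball[of k xs] ball[OF assms] solution_localized[of i]
        solution_localized[of k] \<open>r i \<le> r k\<close>
      by (simp add: pnorm_commute[of _ "x i"] pnorm_commute[of _ "x k"])
    finally have "dnorm B (g i) * pnorm B (x i - y) \<le> dnorm B (g i) * (3 * r k)"
      using dnorm_pos[OF B g_nz, of i] by simp
    then have "g i (x i - y) \<le> dnorm B (g i) * (3 * r k)"
      using abs_le_dnorm_pnorm[OF B, of "g i" "x i - y"] by linarith
    then show "a i * g i (x i - y) \<le> a i * dnorm B (g i) * (3 * r k)"
      using mult_left_mono[OF _ a_nonneg[of i]] by (simp add: mult.assoc)
  qed
  also have "\<dots> = Gamma_sum B a g k * (3 * r k)"
    by (simp add: Gamma_sum_def sum_distrib_right)
  finally show ?thesis .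
qed

text \<open>This links the weights to the trace: the coefficients satisfy a_i^2 = \<theta>^2
  \<gamma> r_i^2 b_i / 4, and a sum of squares of nonnegative numbers is at most the square of their
  sum.\<close>

lemma Gamma_square_ge:
  "(Gamma_sum B a g k)\<^sup>2 \<ge> 1/4 * \<theta>\<^sup>2 * \<gamma> * R\<^sup>2 * (\<Sum>i<k. b i * (dnorm B (g i))\<^sup>2)"
proof -
  have nonneg: "dnorm B (g i) \<ge> 0" for i
    using dnorm_pos[OF B g_nz, of i] by simp
  have "1/4 * \<theta>\<^sup>2 * \<gamma> * R\<^sup>2 * (\<Sum>i<k. b i * (dnorm B (g i))\<^sup>2)
      \<le> (\<Sum>i<k. (a i * dnorm B (g i))\<^sup>2)"
    unfolding sum_distrib_left
  proof (rule sum_mono)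
    fix i
    have "R\<^sup>2 \<le> (r i)\<^sup>2" using r_ge[of i] R by (intro power_mono) auto
    then have "1/4 * \<theta>\<^sup>2 * \<gamma> * (b i * (dnorm B (g i))\<^sup>2) * R\<^sup>2
        \<le> 1/4 * \<theta>\<^sup>2 * \<gamma> * (b i * (dnorm B (g i))\<^sup>2) * (r i)\<^sup>2"
      using \<gamma> b_nonneg[of i] by (intro mult_left_mono) auto
    also have "\<dots> = (a i * dnorm B (g i))\<^sup>2"
      unfolding b_def[of i] a_def[of i]
      by (simp add: power_mult_distrib power_divide power2_eq_square)
    finally show "1/4 * \<theta>\<^sup>2 * \<gamma> * R\<^sup>2 * (b i * (dnorm B (g i))\<^sup>2) \<le> (a i * dnorm B (g i))\<^sup>2"
      by (simp add: mult_ac)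
  qed
  also have "\<dots> \<le> (Gamma_sum B a g k)\<^sup>2"
    using L2_set_le_sum[of "{..<k}" "\<lambda>i. a i * dnorm B (g i)"] a_nonneg nonneg
    unfolding L2_set_def Gamma_sum_def by (intro sqrt_le_D) auto
  finally show ?thesis .
qed

lemma \<theta>_ge: "\<theta> \<ge> 1 / 3"
proof -
  have "4 / 3 \<le> sqrt 2" by (rule real_le_rsqrt) (simp add: power2_eq_square)
  then show ?thesis by (simp add: \<theta>)
qed

lemma Gamma_ge:
  assumes \<gamma>_n: "\<gamma> * DIM('a) \<ge> 1 / 2" and L: "ln (1 + \<gamma>) \<ge> 1 / (2 * real DIM('a))"
    and k: "real k \<ge> 2 * (real DIM('a))\<^sup>2"
  shows "Gamma_sum B a g k \<ge> \<theta> * R / 4 * exp (k * ln (1 + \<gamma>) / (2 * real DIM('a)))"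
proof (rule power2_le_imp_le)
  define n where "n = real DIM('a)"
  define T where "T = (\<Sum>i<k. b i * (dnorm B (g i))\<^sup>2)"
  define P where "P = exp (k * ln (1 + \<gamma>) / n)"
  have n: "n > 0" by (simp add: n_def)
  have "P \<le> 1 + T / n"
    unfolding P_def T_def n_def by (rule trace_lower_bound[OF B b_nonneg b_\<nu>])
  then have T: "n * (P - 1) \<le> T" using n by (simp add: field_simps)
  \<comment> \<open>This is where k >= 2n^2 enters: the exponent of \<open>P\<close> is at least 1,
    hence P >= 2 and P - 1 >= P/2.\<close>
  have "1 \<le> k * (1 / (2 * n)) / n"
    using k n by (simp add: field_simps power2_eq_square n_def)
  also have "\<dots> \<le> k * ln (1 + \<gamma>) / n"
    using L n by (intro divide_right_mono mult_left_mono) (auto simp: n_def)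
  finally have P: "P \<ge> 2"
    unfolding P_def using exp_ge_add_one_self[of "k * ln (1 + \<gamma>) / n"] by linarith
  have "P / 4 = 1/2 * (P / 2)" by simp
  also have "\<dots> \<le> (\<gamma> * n) * (P - 1)"
    using \<gamma>_n P \<gamma> n by (intro mult_mono) (auto simp: n_def)
  also have "\<dots> \<le> \<gamma> * T" using T \<gamma> by (simp add: mult.assoc)
  finally have "1/4 * \<theta>\<^sup>2 * R\<^sup>2 * (P / 4) \<le> 1/4 * \<theta>\<^sup>2 * R\<^sup>2 * (\<gamma> * T)"
    by (rule mult_left_mono) simp
  also have "\<dots> \<le> (Gamma_sum B a g k)\<^sup>2"
    using Gamma_square_ge[of k] by (simp add: T_def mult_ac)
  also have "P = (exp (k * ln (1 + \<gamma>) / (2 * n)))\<^sup>2"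
    by (simp add: P_def exp_double[symmetric])
  finally show "(\<theta> * R / 4 * exp (k * ln (1 + \<gamma>) / (2 * real DIM('a))))\<^sup>2 \<le> (Gamma_sum B a g k)\<^sup>2"
    by (simp add: power_mult_distrib power_divide n_def)
qed (simp add: Gamma_sum_def sum_nonneg a_nonneg less_imp_le[OF dnorm_pos[OF B g_nz]])

lemma gap_le:
  assumes \<gamma>_n: "\<gamma> * DIM('a) \<ge> 1 / 2" and L: "ln (1 + \<gamma>) \<ge> 1 / (2 * real DIM('a))"
    and q1: "ln q \<le> ln (1 + \<gamma>) / (2 * real DIM('a)) - 1 / (8 * (real DIM('a))\<^sup>2)"
    and q2: "ln q \<le> 1 / (6 * (real DIM('a))\<^sup>2)"
    and k: "k \<ge> 1" and y: "w k y \<le> 1/2 * R\<^sup>2" "l k y \<le> 0"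
  shows "- l k y \<le> Gamma_sum B a g k * (6 * exp (- (real k / (8 * (real DIM('a))\<^sup>2))) * R)"
proof -
  define n where "n = real DIM('a)"
  define F where "F = exp (- (real k / (8 * n\<^sup>2)))"
  let ?\<Gamma> = "Gamma_sum B a g k"
  have n: "n \<ge> 1" "n\<^sup>2 > 0" by (simp_all add: n_def DIM_ge_Suc0)
  show ?thesis
  proof (cases "real k \<ge> 2 * n\<^sup>2")
    case True
    define E where "E = exp (k * ln (1 + \<gamma>) / (2 * n))"
    have "k * ln q \<le> k * (ln (1 + \<gamma>) / (2 * n) - 1 / (8 * n\<^sup>2))"
      using q1 by (intro mult_left_mono) (auto simp: n_def)
    then have "exp (k * ln q) \<le> exp (k * ln (1 + \<gamma>) / (2 * n) + (- (real k / (8 * n\<^sup>2))))"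
      by (simp add: right_diff_distrib)
    then have "exp (k * ln q) \<le> E * F" unfolding exp_add E_def F_def .
    then have "(r k)\<^sup>2 \<le> E * F * R\<^sup>2"
      using r_square_le[of k] mult_right_mono[of "exp (k * ln q)" "E * F" "R\<^sup>2"] by simp
    then have "- l k y \<le> 1/2 * (E * F * R\<^sup>2)"
      using neg_l_le_radius[OF y(1)] by linarith
    also have "\<dots> = (E * F * R\<^sup>2) * (1/2 * 1)" by simp
    \<comment> \<open>A factor 3 \<theta> >= 1 is inserted so that the lower bound for
      \<open>Gamma_sum\<close> can be split off.\<close>
    also have "\<dots> \<le> (E * F * R\<^sup>2) * (1/2 * (3 * \<theta>))"
      using \<theta>_ge by (intro mult_left_mono) (auto simp: E_def F_def)
    also have "\<dots> = (\<theta> * R / 4 * E) * (6 * F * R)"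
      by (simp add: power2_eq_square)
    also have "\<dots> \<le> ?\<Gamma> * (6 * F * R)"
      using Gamma_ge[OF \<gamma>_n L, of k] True R
      by (intro mult_right_mono) (auto simp: n_def E_def F_def)
    finally show ?thesis by (simp add: F_def n_def)
  next
    case False
    have "k * ln q \<le> k * (1 / (6 * n\<^sup>2))"
      using q2 by (intro mult_left_mono) (auto simp: n_def)
    \<comment> \<open>The claim amounts to k/(6n^2) + k/(4n^2) <= 1. For k < 2n^2 the left side is
      below 5/6.\<close>
    also have "\<dots> \<le> 1 + 2 * (- (real k / (8 * n\<^sup>2)))"
      using False n by (simp add: field_simps)
    finally have "exp (k * ln q) \<le> exp 1 * F\<^sup>2"
      by (simp add: F_def flip: exp_double exp_add)
    also have "\<dots> \<le> 4 * F\<^sup>2"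
      using exp_le by (intro mult_right_mono) auto
    finally have "exp (k * ln q) * R\<^sup>2 \<le> 4 * F\<^sup>2 * R\<^sup>2"
      by (rule mult_right_mono) simp
    then have "(r k)\<^sup>2 \<le> (2 * F * R)\<^sup>2"
      using r_square_le[of k] by (simp add: power_mult_distrib)
    then have "r k \<le> 2 * F * R"
      by (rule power2_le_imp_le) (use R in \<open>simp add: F_def\<close>)
    then have "?\<Gamma> * (3 * r k) \<le> ?\<Gamma> * (6 * F * R)"
      using Gamma_pos[OF k] by (intro mult_left_mono) auto
    with neg_l_le_Gamma[OF y] show ?thesis
      unfolding F_def n_def by (rule order_trans)
  qed
qed

end

theorem theorem1:
  fixes B :: "'a::euclidean_space \<Rightarrow>\<^sub>L 'a dual"
    and Or :: "'a \<Rightarrow> 'a dual"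
    and x0 :: 'a
    and R \<theta> \<gamma> :: real
    and n :: nat
    and a b U :: "nat \<Rightarrow> real"
    and x :: "nat \<Rightarrow> 'a"
    and g :: "nat \<Rightarrow> 'a dual"
    and l w :: "nat \<Rightarrow> 'a \<Rightarrow> real"
  assumes "n = DIM('a)" and "n \<ge> 1"
    and "self_adjoint_pos_def B"
    and "R > 0"
    and "\<exists>xs. pnorm B (xs - x0) \<le> R \<and> (\<forall>y. Or y (y - xs) \<ge> 0)"
    and "\<theta> = sqrt 2 - 1"
    and "\<gamma> = 2 / (sqrt (4 * (real n)\<^sup>2 - 1) + 2 * real n - 1)"
    and "general_scheme B Or x0 R a b x g U l w"
    and "\<And>k. a k = (1/2 * \<theta> * \<gamma> * radius B R a b g U k) / dnorm (hess_op B b g k) (g k)"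
    and "\<And>k. b k = \<gamma> / (dnorm (hess_op B b g k) (g k))\<^sup>2"
    and "\<And>k. g k \<noteq> 0"
  shows "\<forall>k\<ge>1. \<exists>D. is_sliding_gap B R a g l w k D \<and>
           D \<le> 6 * exp (- (real k / (8 * (real n)\<^sup>2))) * R"
proof (intro allI impI)
  fix k :: nat assume k: "k \<ge> 1"
  note rate = rate_constants[OF assms(2,7)]
  obtain xs where xs: "pnorm B (xs - x0) \<le> R" "\<And>y. Or y (y - xs) \<ge> 0"
    using assms(5) by blast
  interpret subgradient_ellipsoid_run B Or x0 xs R \<theta> \<gamma> a b U x g l w
    by unfold_locales (fact assms xs rate(1))+
  let ?\<Gamma> = "Gamma_sum B a g k" and ?\<Omega> = "Omega_set R (w k)"
  let ?f = "\<lambda>y. 1 / ?\<Gamma> * (- l k y)" and ?c = "6 * exp (- (real k / (8 * (real n)\<^sup>2))) * R"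
  have "xs \<in> ?\<Omega>" using solution_localized by (simp add: Omega_set_def)
  moreover have "continuous_on ?\<Omega> ?f"
    by (intro continuous_intros continuous_on_l)
  ultimately obtain y where y: "y \<in> ?\<Omega>" "\<And>z. z \<in> ?\<Omega> \<Longrightarrow> ?f z \<le> ?f y"
    using continuous_attains_sup[OF compact_Omega] by blast
  have "is_sliding_gap B R a g l w k (?f y)"
    unfolding is_sliding_gap_def is_maximum_def using k Gamma_pos[OF k] y by blast
  moreover have "- l k y \<le> ?\<Gamma> * ?c"
  \<comment> \<open>The gap is a maximum over all of Omega_k, while \<open>gap_le\<close> covers
    only points with \<open>l k y \<le> 0\<close>. At other points the left side is
    negative.\<close>
  proof (cases "l k y \<le> 0")
    case True
    with y(1) k rate show ?thesis
      using gap_le[of k y] by (simp add: Omega_set_def assms(1))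
  next
    case False
    moreover have "?\<Gamma> * ?c \<ge> 0" using Gamma_pos[OF k] assms(4) by simp
    ultimately show ?thesis by linarith
  qed
  then have "?f y \<le> ?c" using Gamma_pos[OF k] by (simp add: field_simps)
  ultimately show "\<exists>D. is_sliding_gap B R a g l w k D \<and> D \<le> ?c" by blast
qed

end
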